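(* Let $\Sigma_f$ be a rotational Ricci surface in $\mathbb{R}^3$ with negative Gaussian curvature, where $f:\mathbb{R}\to\mathbb{R}$ is the positive smooth function given by $$f(s)=\sqrt{bs^2+2cs+d}$$ for $b,c,d\in\mathbb{R}$ with $0<b\le1$ and $c^2<bd$. Then: 1. $\Sigma_f$ is a proper surface; 2. up to a vertical isometry of $\mathbb{R}^3$, $\Sigma_f$ is symmetric with respect to the $xy$-plane; 3. $\Sigma_f$ is a catenoid if and only if $b=1$.
   Context: Rotational surfaces: let $I\subseteq\mathbb{R}$ be an open interval, and let $f,g:I\to\mathbb{R}$ be smooth with $f>0$, $(f')^2+(g')^2=1$ and $g'\ge 0$. The rotational surface $\Sigma_f\subset\mathbb{R}^3$ is the surface parametrised by $X(s,\theta)=(f(s)\cos\theta,f(s)\sin\theta,g(s))$. Up to a vertical isometry of $\mathbb{R}^3$, $g(s)=\int_{s_0}^s\sqrt{1-f'(\zeta)^2}\,d\zeta$ with $s_0\in I$, so $\Sigma_f$ is determined by $f$ up to a vertical isometry. The induced metric is $ds^2+f(s)^2d\theta^2$ and the Gaussian curvature is $K=-f''/f$. A rotational Ricci surface is a rotational surface $\Sigma_f$ whose Gaussian curvature satisfies the Ricci condition $K\Delta K-\|\nabla K\|^2-4K^3=0$, equivalently $KK''-(K')^2-4K^3+\frac{f'}{f}KK'=0$ with $K=-f''/f$. *)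

theory Defs
  imports "HOL-Analysis.Analysis"
begin

section \<open>Parametrised surfaces in Euclidean space\<close>

definition smooth_on_open :: "real set \<Rightarrow> (real \<Rightarrow> real) \<Rightarrow> bool" where
  "smooth_on_open I h \<longleftrightarrow> (\<forall>n. \<forall>s\<in>I. ((deriv ^^ n) h) field_differentiable (at s))"

definition partial1 :: "(real \<Rightarrow> real \<Rightarrow> 'a::real_normed_vector) \<Rightarrow> real \<Rightarrow> real \<Rightarrow> 'a" where
  "partial1 u s t = vector_derivative (\<lambda>x. u x t) (at s)"

definition partial2 :: "(real \<Rightarrow> real \<Rightarrow> 'a::real_normed_vector) \<Rightarrow> real \<Rightarrow> real \<Rightarrow> 'a" where
  "partial2 u s t = vector_derivative (\<lambda>y. u s y) (at t)"

text \<open>In the following, \<open>X\<close> is a parametrisation, and \<open>ff_E\<close>, \<open>ff_F\<close>, \<open>ff_G\<close> are the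
  coefficients of its first fundamental form.\<close>

definition ff_E :: "(real \<Rightarrow> real \<Rightarrow> real^3) \<Rightarrow> real \<Rightarrow> real \<Rightarrow> real" where
  "ff_E X s t = partial1 X s t \<bullet> partial1 X s t"

definition ff_F :: "(real \<Rightarrow> real \<Rightarrow> real^3) \<Rightarrow> real \<Rightarrow> real \<Rightarrow> real" where
  "ff_F X s t = partial1 X s t \<bullet> partial2 X s t"

definition ff_G :: "(real \<Rightarrow> real \<Rightarrow> real^3) \<Rightarrow> real \<Rightarrow> real \<Rightarrow> real" where
  "ff_G X s t = partial2 X s t \<bullet> partial2 X s t"

definition ff_det :: "(real \<Rightarrow> real \<Rightarrow> real^3) \<Rightarrow> real \<Rightarrow> real \<Rightarrow> real" where
  "ff_det X s t = ff_E X s t * ff_G X s t - (ff_F X s t)\<^sup>2"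

definition unit_normal :: "(real \<Rightarrow> real \<Rightarrow> real^3) \<Rightarrow> real \<Rightarrow> real \<Rightarrow> real^3" where
  "unit_normal X s t = sgn (cross3 (partial1 X s t) (partial2 X s t))"

text \<open>The quotient of the determinants of the second and the first fundamental form.\<close>

definition gauss_curvature :: "(real \<Rightarrow> real \<Rightarrow> real^3) \<Rightarrow> real \<Rightarrow> real \<Rightarrow> real" where
  "gauss_curvature X s t =
     ((partial1 (partial1 X) s t \<bullet> unit_normal X s t) * (partial2 (partial2 X) s t \<bullet> unit_normal X s t)
       - (partial1 (partial2 X) s t \<bullet> unit_normal X s t)\<^sup>2) / ff_det X s t"

text \<open>Squared norm of the gradient and Laplace-Beltrami operator of the induced metric, in the
  coordinates given by \<open>X\<close>; the Laplacian has the sign of \<open>div grad\<close>.\<close>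

definition grad_norm_sq ::
    "(real \<Rightarrow> real \<Rightarrow> real^3) \<Rightarrow> (real \<Rightarrow> real \<Rightarrow> real) \<Rightarrow> real \<Rightarrow> real \<Rightarrow> real" where
  "grad_norm_sq X u s t =
     (ff_G X s t * (partial1 u s t)\<^sup>2 - 2 * ff_F X s t * partial1 u s t * partial2 u s t
       + ff_E X s t * (partial2 u s t)\<^sup>2) / ff_det X s t"

definition laplace_beltrami ::
    "(real \<Rightarrow> real \<Rightarrow> real^3) \<Rightarrow> (real \<Rightarrow> real \<Rightarrow> real) \<Rightarrow> real \<Rightarrow> real \<Rightarrow> real" where
  "laplace_beltrami X u s t =
     (partial1 (\<lambda>x y. (ff_G X x y * partial1 u x y - ff_F X x y * partial2 u x y) / sqrt (ff_det X x y)) s t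
      + partial2 (\<lambda>x y. (ff_E X x y * partial2 u x y - ff_F X x y * partial1 u x y) / sqrt (ff_det X x y)) s t)
     / sqrt (ff_det X s t)"

definition ricci_condition :: "(real \<Rightarrow> real \<Rightarrow> real^3) \<Rightarrow> real \<Rightarrow> real \<Rightarrow> bool" where
  "ricci_condition X s t \<longleftrightarrow>
     gauss_curvature X s t * laplace_beltrami X (gauss_curvature X) s t
       - grad_norm_sq X (gauss_curvature X) s t - 4 * (gauss_curvature X s t) ^ 3 = 0"

section \<open>Rotational surfaces\<close>

definition rotational_profile :: "real set \<Rightarrow> (real \<Rightarrow> real) \<Rightarrow> (real \<Rightarrow> real) \<Rightarrow> bool" where
  "rotational_profile I f g \<longleftrightarrow>
     open I \<and> is_interval I \<and> I \<noteq> {} \<and> smooth_on_open I f \<and> smooth_on_open I g \<and>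
     (\<forall>s\<in>I. f s > 0 \<and> (deriv f s)\<^sup>2 + (deriv g s)\<^sup>2 = 1 \<and> deriv g s \<ge> 0)"

definition rot_param :: "(real \<Rightarrow> real) \<Rightarrow> (real \<Rightarrow> real) \<Rightarrow> real \<Rightarrow> real \<Rightarrow> real^3" where
  "rot_param f g s \<theta> = vector [f s * cos \<theta>, f s * sin \<theta>, g s]"

definition rotational_surface :: "real set \<Rightarrow> (real \<Rightarrow> real) \<Rightarrow> (real \<Rightarrow> real) \<Rightarrow> (real^3) set" where
  "rotational_surface I f g = {rot_param f g s \<theta> | s \<theta>. s \<in> I}"

definition rotational_ricci_surface :: "real set \<Rightarrow> (real \<Rightarrow> real) \<Rightarrow> (real \<Rightarrow> real) \<Rightarrow> bool" where
  "rotational_ricci_surface I f g \<longleftrightarrow>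
     rotational_profile I f g \<and> (\<forall>s\<in>I. \<forall>\<theta>. ricci_condition (rot_param f g) s \<theta>)"

text \<open>As \<open>rot_param f g\<close> is periodic in the angle, it is never a proper map. The surface itself is
  \<open>I \<times> S\<^sup>1\<close>, with \<open>S\<^sup>1\<close> the unit circle in the complex plane, immersed by the map below, and
  \<open>rot_param f g s \<theta> = rot_immersion f g (s, cis \<theta>)\<close>. The surface is proper if this map is
  proper.\<close>

definition rot_immersion :: "(real \<Rightarrow> real) \<Rightarrow> (real \<Rightarrow> real) \<Rightarrow> real \<times> complex \<Rightarrow> real^3" where
  "rot_immersion f g = (\<lambda>(s, w). vector [f s * Re w, f s * Im w, g s])"

definition proper_rotational_surface :: "real set \<Rightarrow> (real \<Rightarrow> real) \<Rightarrow> (real \<Rightarrow> real) \<Rightarrow> bool" where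
  "proper_rotational_surface I f g \<longleftrightarrow>
     continuous_map (top_of_set (I \<times> sphere 0 1)) euclidean (rot_immersion f g) \<and>
     proper_map (top_of_set (I \<times> sphere 0 1)) euclidean (rot_immersion f g)"

section \<open>Isometries, symmetry and catenoids\<close>

definition isometry_R3 :: "(real^3 \<Rightarrow> real^3) \<Rightarrow> bool" where
  "isometry_R3 T \<longleftrightarrow> (\<forall>p q. dist (T p) (T q) = dist p q)"

text \<open>The isometries that act only on the height: vertical translations, possibly composed with
  the reflection in the \<open>xy\<close>-plane.\<close>

definition vertical_isometry :: "(real^3 \<Rightarrow> real^3) \<Rightarrow> bool" where
  "vertical_isometry T \<longleftrightarrow>
     isometry_R3 T \<and> (\<exists>h::real \<Rightarrow> real. \<forall>p. T p = vector [p $ 1, p $ 2, h (p $ 3)])"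

definition xy_reflection :: "real^3 \<Rightarrow> real^3" where
  "xy_reflection p = vector [p $ 1, p $ 2, - p $ 3]"

definition symmetric_xy_plane :: "(real^3) set \<Rightarrow> bool" where
  "symmetric_xy_plane S \<longleftrightarrow> xy_reflection ` S = S"

text \<open>A catenoid is, in some position in space, the surface generated by rotating the catenary
  \<open>x = a cosh (z / a)\<close> about the \<open>z\<close>-axis.\<close>

definition catenoid :: "(real^3) set \<Rightarrow> bool" where
  "catenoid S \<longleftrightarrow> (\<exists>a>0. \<exists>T. isometry_R3 T \<and>
     S = T ` rotational_surface UNIV (\<lambda>u. a * cosh (u / a)) (\<lambda>u. u))"

end

theory Submission
  imports Defs "HOL-Real_Asymp.Real_Asymp"
begin

text \<open>
  Since \<open>f\<^sup>2\<close> is a quadratic polynomial in \<open>s\<close> with positive leading coefficient, \<open>f\<close> is coercive,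
  which gives properness, and even about \<open>a = -c/b\<close>; so \<open>g'\<close>, which is determined by \<open>f'\<close>, is even
  about \<open>a\<close>, and \<open>g - g a\<close> is odd. For \<open>b = 1\<close>, with \<open>e\<^sup>2 = d - c\<^sup>2\<close>, one can integrate:
  \<open>g s = k + e arsinh ((s + c) / e)\<close> and hence \<open>f = e cosh ((g - k) / e)\<close>. For \<open>b < 1\<close> the surface
  is asymptotic to a cone: \<open>f s / s\<close> tends to \<open>sqrt b\<close>, and \<open>g' \<ge> sqrt (1 - b) > 0\<close>. A catenoid, on
  the other hand, is asymptotic to a plane: the distance of its points \<open>p\<close> to a fixed plane is
  \<open>O(sqrt |p|)\<close>, a property that survives every isometry of space and fails for the cone.
\<close>

section \<open>Properness\<close>

lemma continuous_on_vector_3: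
  fixes u v w :: "'a::topological_space \<Rightarrow> real"
  assumes "continuous_on A u" "continuous_on A v" "continuous_on A w"
  shows "continuous_on A (\<lambda>x. vector [u x, v x, w x] :: real^3)"
proof -
  \<comment> \<open>\<open>vector\<close> builds its value from a list; as a function of the index
    it falls under the componentwise continuity rule.\<close>
  have "(vector [u x, v x, w x] :: real^3) =
      (\<chi> i. if i = 1 then u x else if i = 2 then v x else w x)" for x
    by (simp add: vec_eq_iff forall_3)
  then show ?thesis
  proof (simp only:, intro continuous_on_vec_lambda)
    show "continuous_on A (\<lambda>x. if i = 1 then u x else if i = 2 then v x else w x)" for i :: 3
      using assms by (cases "i = 1"; cases "i = 2") simp_all
  qed
qed

lemma norm_rot_immersion:
  assumes "cmod w = 1"
  shows "norm (rot_immersion f g (s, w)) = sqrt ((f s)\<^sup>2 + (g s)\<^sup>2)"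
proof -
  have "(Re w)\<^sup>2 + (Im w)\<^sup>2 = 1"
    using assms by (simp add: cmod_def)
  moreover have "(f s * Re w)\<^sup>2 + (f s * Im w)\<^sup>2 = (f s)\<^sup>2 * ((Re w)\<^sup>2 + (Im w)\<^sup>2)"
    by algebra
  ultimately show ?thesis
    by (simp add: rot_immersion_def norm_eq_sqrt_inner inner_vec_def sum_3 flip: power2_eq_square)
qed

text \<open>By \<open>norm_rot_immersion\<close> the norm of an image point is at least |f s|, and
  the circle factor is compact; so the preimage of a compact set is bounded as well as
  closed.\<close>

lemma proper_rotational_surface_UNIV:
  assumes f: "continuous_on UNIV f" and g: "continuous_on UNIV g"
    and bdd: "\<And>r. bounded {s. \<bar>f s\<bar> \<le> r}"
  shows "proper_rotational_surface UNIV f g"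
proof -
  let ?X = "UNIV \<times> sphere 0 1 :: (real \<times> complex) set"
  have cont: "continuous_on A (rot_immersion f g)" for A
    unfolding rot_immersion_def case_prod_unfold
    by (intro continuous_on_vector_3 continuous_intros
          continuous_on_compose2[OF f] continuous_on_compose2[OF g]) auto
  have cm: "continuous_map (top_of_set ?X) euclidean (rot_immersion f g)"
    using cont by simp
  have "compact {x \<in> ?X. rot_immersion f g x \<in> K}" if K: "compact K" for K
  proof -
    obtain r where r: "\<And>p. p \<in> K \<Longrightarrow> norm p \<le> r"
      using compact_imp_bounded[OF K] by (auto simp: bounded_iff)
    have "\<bar>f s\<bar> \<le> r" if "cmod w = 1" "rot_immersion f g (s, w) \<in> K" for s w
      using r[OF that(2)] that(1) norm_rot_immersion[OF that(1), of f g s]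
      by (smt (verit) real_sqrt_abs real_sqrt_le_mono zero_le_power2)
    then have "{x \<in> ?X. rot_immersion f g x \<in> K} \<subseteq> {s. \<bar>f s\<bar> \<le> r} \<times> sphere 0 1"
      by auto
    then have "bounded {x \<in> ?X. rot_immersion f g x \<in> K}"
      by (rule bounded_subset[rotated]) (intro bounded_Times bdd bounded_sphere)
    moreover have "{x \<in> ?X. rot_immersion f g x \<in> K} = ?X \<inter> rot_immersion f g -` K"
      by auto
    moreover have "closed (?X \<inter> rot_immersion f g -` K)"
      by (intro continuous_closed_preimage cont closed_Times closed_UNIV closed_sphere
            compact_imp_closed K)
    ultimately show ?thesis
      by (simp add: compact_eq_bounded_closed)
  qed
  \<comment> \<open>Compact preimages make a continuous map proper when the target is a Hausdorff
    k-space; metrizability supplies both.\<close>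
  then have "proper_map (top_of_set ?X) euclidean (rot_immersion f g)"
    using cm
    by (intro compact_imp_proper_map metrizable_imp_k_space Hausdorff_imp_kc_space
          metrizable_space_euclidean metrizable_imp_Hausdorff_space) (auto simp: compactin_subtopology)
  with cm show ?thesis
    by (simp add: proper_rotational_surface_def)
qed

section \<open>Symmetry\<close>

text \<open>Unit speed together with g' >= 0 leaves only the nonnegative root for g', so
  \<open>f\<close> determines \<open>g\<close> up to a constant.\<close>

lemma rotational_profile_UNIV_DERIV:
  assumes "rotational_profile UNIV f g"
  shows "(f has_real_derivative deriv f s) (at s)"
    and "(g has_real_derivative sqrt (1 - (deriv f s)\<^sup>2)) (at s)"
proof -
  have "((deriv ^^ 0) f) field_differentiable (at s)" "((deriv ^^ 0) g) field_differentiable (at s)"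
    using assms unfolding rotational_profile_def smooth_on_open_def by blast+
  then have D: "(f has_real_derivative deriv f s) (at s)" "(g has_real_derivative deriv g s) (at s)"
    by (simp_all add: DERIV_deriv_iff_field_differentiable)
  have "(deriv f s)\<^sup>2 + (deriv g s)\<^sup>2 = 1" "deriv g s \<ge> 0"
    using assms by (auto simp: rotational_profile_def)
  then have "sqrt (1 - (deriv f s)\<^sup>2) = deriv g s"
    by (intro real_sqrt_unique) auto
  with D show "(f has_real_derivative deriv f s) (at s)"
    and "(g has_real_derivative sqrt (1 - (deriv f s)\<^sup>2)) (at s)"
    by simp_all
qed

text \<open>Reflection in \<open>a\<close> changes the sign of f' and so preserves g' = sqrt (1 -
  f'^2). Hence g (a + t) + g (a - t) has derivative 0 in \<open>t\<close>.\<close>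

lemma rotational_profile_odd:
  assumes prof: "rotational_profile UNIV f g" and even: "\<And>t. f (a + t) = f (a - t)"
  shows "g (a + t) + g (a - t) = 2 * g a"
proof -
  note D = rotational_profile_UNIV_DERIV[OF prof]
  have deriv: "deriv f (a + t) = - deriv f (a - t)" for t
  proof -
    have "((\<lambda>t. f (a + t)) has_real_derivative deriv f (a + t)) (at t)"
      using D(1)[of "a + t"] DERIV_shift[of f _ t a] by (simp add: add.commute)
    moreover have "((\<lambda>t. f (a - t)) has_real_derivative - deriv f (a - t)) (at t)"
    proof -
      have "((\<lambda>t. a - t) has_real_derivative - 1) (at t)"
        by (auto intro!: derivative_eq_intros)
      from DERIV_chain2[OF D(1) this] show ?thesis
        by simp
    qed
    ultimately show ?thesis
      by (simp add: even DERIV_unique)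
  qed
  have "((\<lambda>t. g (a + t) + g (a - t)) has_real_derivative 0) (at t)" for t
    by (auto intro!: derivative_eq_intros DERIV_chain2[OF D(2)] simp: deriv)
  then have "g (a + t) + g (a - t) = g (a + 0) + g (a - 0)"
    using DERIV_isconst_all[of "\<lambda>t. g (a + t) + g (a - t)" t 0] by blast
  then show ?thesis
    by simp
qed

definition vertical_translation :: "real \<Rightarrow> real^3 \<Rightarrow> real^3" where
  "vertical_translation k p = vector [p $ 1, p $ 2, p $ 3 + k]"

lemma vertical_isometry_translation: "vertical_isometry (vertical_translation k)"
  unfolding vertical_isometry_def isometry_R3_def vertical_translation_def
  by (auto simp: dist_norm norm_eq_sqrt_inner inner_vec_def sum_3 intro: exI[of _ "\<lambda>z. z + k"])

lemma vertical_translation_rotational_surface: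
  "vertical_translation k ` rotational_surface I f g = rotational_surface I f (\<lambda>s. g s + k)"
proof -
  have "vertical_translation k (rot_param f g s \<theta>) = rot_param f (\<lambda>s. g s + k) s \<theta>" for s \<theta>
    by (simp add: rot_param_def vertical_translation_def)
  then show ?thesis
    unfolding rotational_surface_def by (force simp: image_iff)
qed

text \<open>The parameter change s -> 2 a - s, at a fixed angle, carries out the reflection. This
  gives one inclusion; the other follows because the reflection is an involution.\<close>

lemma symmetric_xy_plane_rotational_surface:
  assumes "\<And>t. f (a + t) = f (a - t)" "\<And>t. g (a + t) = - g (a - t)"
  shows "symmetric_xy_plane (rotational_surface UNIV f g)"
proof -
  have "xy_reflection (rot_param f g s \<theta>) = rot_param f g (2 * a - s) \<theta>" for s \<theta>
    using assms[of "s - a"] by (simp add: xy_reflection_def rot_param_def)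
  then have sub: "xy_reflection ` rotational_surface UNIV f g \<subseteq> rotational_surface UNIV f g"
    by (auto simp: rotational_surface_def)
  have "xy_reflection (xy_reflection p) = p" for p
    by (simp add: xy_reflection_def vec_eq_iff forall_3)
  with sub show ?thesis
    unfolding symmetric_xy_plane_def by (metis imageI subset_antisym subset_iff)
qed

section \<open>Catenoids\<close>

text \<open>Taking the height \<open>g s\<close> as the new parameter turns the profile into the
  catenary with neck radius \<open>a\<close> at height \<open>k\<close>. Surjectivity of
  \<open>g\<close> ensures that the whole catenary is covered.\<close>

lemma catenoid_rotational_surface:
  assumes a: "a > 0" and f: "\<And>s. f s = a * cosh ((g s - k) / a)" and g: "surj g"
  shows "catenoid (rotational_surface UNIV f g)"
proof -
  have "rotational_surface UNIV f g
      = rotational_surface UNIV (\<lambda>u. a * cosh (u / a)) (\<lambda>u. u + k)" (is "?S = ?S'")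
  proof
    have "rot_param f g s \<theta> = rot_param (\<lambda>u. a * cosh (u / a)) (\<lambda>u. u + k) (g s - k) \<theta>" for s \<theta>
      by (simp add: rot_param_def f)
    then show "?S \<subseteq> ?S'"
      unfolding rotational_surface_def by blast
    have "\<exists>s. rot_param (\<lambda>u. a * cosh (u / a)) (\<lambda>u. u + k) u \<theta> = rot_param f g s \<theta>" for u \<theta>
    proof -
      obtain s where "u + k = g s"
        using g by (metis surjD)
      then have "rot_param (\<lambda>u. a * cosh (u / a)) (\<lambda>u. u + k) u \<theta> = rot_param f g s \<theta>"
        by (simp add: rot_param_def f flip: \<open>u + k = g s\<close>)
      then show ?thesis ..
    qed
    then show "?S' \<subseteq> ?S"
      unfolding rotational_surface_def by blast
  qed
  then have "rotational_surface UNIV f g = vertical_translation k `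
      rotational_surface UNIV (\<lambda>u. a * cosh (u / a)) (\<lambda>u. u)"
    by (simp add: vertical_translation_rotational_surface)
  then show ?thesis
    unfolding catenoid_def using a vertical_isometry_translation vertical_isometry_def by blast
qed

text \<open>The map q -> T q - T 0 is an isometry fixing the origin, hence orthogonal. It preserves
  inner products, so \<open>n\<close> can be the image of the third basis vector.\<close>

lemma isometry_R3_height:
  assumes "isometry_R3 T"
  obtains n where "norm n = 1" "\<And>q. (T q - T 0) \<bullet> n = q $ 3"
proof -
  define A where "A = (\<lambda>q. T q - T 0)"
  have "orthogonal_transformation A"
    using assms unfolding orthogonal_transformation_isometry isometry_R3_def A_def
    by (auto simp: dist_norm)
  then have A: "A p \<bullet> A q = p \<bullet> q" "norm (A q) = norm q" for p q
    by (auto simp: orthogonal_transformation_def orthogonal_transformation_norm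
        orthogonal_transformation)
  show thesis
  proof
    show "norm (A (axis 3 1)) = 1"
      by (simp add: A(2))
    show "(T q - T 0) \<bullet> A (axis 3 1) = q $ 3" for q
      using A(1)[of q "axis 3 1"] by (simp add: A_def inner_axis)
  qed
qed

text \<open>The plane is the image under \<open>T\<close> of z = 0, and \<open>t\<close> is
  \<open>T 0\<close>. A point at height \<open>u\<close> of the standard catenoid has norm at least
  a cosh (u / a), which dominates u^2.\<close>

lemma catenoid_near_plane:
  assumes "catenoid S"
  obtains n t C where "norm n = 1" "C > 0"
    "\<And>p. p \<in> S \<Longrightarrow> ((p - t) \<bullet> n)\<^sup>2 \<le> C * norm (p - t)"
proof -
  obtain a T where a: "a > 0" and T: "isometry_R3 T"
    and S: "S = T ` rotational_surface UNIV (\<lambda>u. a * cosh (u / a)) (\<lambda>u. u)"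
    using assms by (auto simp: catenoid_def)
  obtain n where n: "norm n = 1" "\<And>q. (T q - T 0) \<bullet> n = q $ 3"
    by (rule isometry_R3_height[OF T]) blast
  have height: "u\<^sup>2 \<le> 4 * a * (a * cosh (u / a))" for u
  proof -
    \<comment> \<open>For x >= 0, 2 cosh x >= exp x >= x^2 / 2; this is the origin of the factor
      4.\<close>
    have "(u / a)\<^sup>2 \<le> 4 * cosh \<bar>u / a\<bar>"
      using exp_lower_Taylor_quadratic[of "\<bar>u / a\<bar>"]
        exp_ge_zero[of "- \<bar>u / a\<bar>"] zero_le_power2[of "u / a"]
      unfolding cosh_def power2_abs by (simp del: exp_ge_zero abs_divide)
    then have "(u / a)\<^sup>2 * a\<^sup>2 \<le> 4 * cosh (u / a) * a\<^sup>2"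
      by (intro mult_right_mono) (simp_all only: cosh_real_abs zero_le_power2)
    then show ?thesis
      using a by (simp add: power_divide power2_eq_square algebra_simps)
  qed
  show thesis
  proof
    show "norm n = 1" by fact
    show "4 * a > 0" using a by simp
    fix p assume "p \<in> S"
    then obtain u \<theta> where p: "p = T (rot_param (\<lambda>u. a * cosh (u / a)) (\<lambda>u. u) u \<theta>)"
      by (auto simp: S rotational_surface_def)
    let ?q = "rot_param (\<lambda>u. a * cosh (u / a)) (\<lambda>u. u) u \<theta>"
    have "norm (p - T 0) = norm ?q"
      using T by (simp add: p isometry_R3_def flip: dist_norm)
    also have "?q = rot_immersion (\<lambda>u. a * cosh (u / a)) (\<lambda>u. u) (u, cis \<theta>)"
      by (simp add: rot_param_def rot_immersion_def)
    also have "norm \<dots> \<ge> a * cosh (u / a)"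
      by (subst norm_rot_immersion) (auto intro: real_le_rsqrt)
    finally have "4 * a * (a * cosh (u / a)) \<le> 4 * a * norm (p - T 0)"
      using a by (intro mult_left_mono) auto
    moreover have "(p - T 0) \<bullet> n = u"
      by (simp add: p n(2) rot_param_def)
    ultimately show "((p - T 0) \<bullet> n)\<^sup>2 \<le> 4 * a * norm (p - T 0)"
      using height[of u] by simp
  qed
qed

text \<open>Along each meridian points recede only linearly, so near a catenoid's plane the normal
  component would be O(sqrt s). Dividing by \<open>s\<close> and letting \<open>s\<close> tend to
  infinity kills every component of the normal \<open>n\<close>.\<close>

lemma not_catenoid_of_linear_growth:
  assumes f: "((\<lambda>s. f s / s) \<longlongrightarrow> \<beta>) at_top" "\<beta> \<noteq> 0"
    and g: "\<And>s. s \<ge> 0 \<Longrightarrow> \<gamma> * s + k \<le> g s" "\<And>s. s \<ge> 0 \<Longrightarrow> \<bar>g s\<bar> \<le> s + l" and \<gamma>: "\<gamma> > 0"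
  shows "\<not> catenoid (rotational_surface UNIV f g)"
proof
  assume "catenoid (rotational_surface UNIV f g)"
  then obtain n t :: "real^3" and C where n: "norm n = 1" and C: "C > 0"
    and near: "\<And>p. p \<in> rotational_surface UNIV f g \<Longrightarrow> ((p - t) \<bullet> n)\<^sup>2 \<le> C * norm (p - t)"
    by (rule catenoid_near_plane) blast
  define h where "h \<theta> s = ((rot_param f g s \<theta> - t) \<bullet> n) / s" for \<theta> s
  have h_eq: "h \<theta> s = f s / s * (cos \<theta> * n $ 1 + sin \<theta> * n $ 2) + g s / s * n $ 3 - (t \<bullet> n) / s"
    for \<theta> s
    by (simp add: h_def inner_diff_left)
      (simp add: rot_param_def inner_vec_def sum_3 algebra_simps add_divide_distrib diff_divide_distrib)
  have h0: "(h \<theta> \<longlongrightarrow> 0) at_top" for \<theta>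
  proof -
    \<comment> \<open>\<open>U s\<close> is C / s^2 times a bound for the distance from
      \<open>t\<close>, split into summands that each tend to 0.\<close>
    define U where "U s = C * (2 * \<bar>f s / s\<bar> * (1 / s) + (s + l) / s\<^sup>2 + norm t / s\<^sup>2)" for s
    have "((\<lambda>s. (s + l) / s\<^sup>2) \<longlongrightarrow> 0) at_top" "((\<lambda>s. norm t / s\<^sup>2) \<longlongrightarrow> 0) at_top"
      "((\<lambda>s::real. 1 / s) \<longlongrightarrow> 0) at_top"
      by real_asymp+
    then have "(U \<longlongrightarrow> C * (2 * \<bar>\<beta>\<bar> * 0 + 0 + 0)) at_top"
      unfolding U_def by (intro tendsto_intros f)
    then have "(U \<longlongrightarrow> 0) at_top"
      by simp
    moreover have "eventually (\<lambda>s. norm ((h \<theta> s)\<^sup>2) \<le> U s) at_top"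
      using eventually_gt_at_top[of 0]
    proof eventually_elim
      case (elim s)
      have "norm (rot_param f g s \<theta>) \<le> \<bar>f s * cos \<theta>\<bar> + \<bar>f s * sin \<theta>\<bar> + \<bar>g s\<bar>"
        using norm_le_l1_cart[of "rot_param f g s \<theta>"] by (simp add: sum_3 rot_param_def)
      also have "\<dots> \<le> \<bar>f s\<bar> + \<bar>f s\<bar> + (s + l)"
        using elim by (intro add_mono g) (auto simp: abs_mult mult_left_le)
      finally have "norm (rot_param f g s \<theta> - t) \<le> 2 * \<bar>f s\<bar> + (s + l) + norm t"
        using norm_triangle_ineq4[of "rot_param f g s \<theta>" t] by linarith
      moreover have "rot_param f g s \<theta> \<in> rotational_surface UNIV f g"
        by (auto simp: rotational_surface_def)
      ultimately have "((rot_param f g s \<theta> - t) \<bullet> n)\<^sup>2 \<le> C * (2 * \<bar>f s\<bar> + (s + l) + norm t)"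
        using near C by (meson mult_left_mono less_imp_le order_trans)
      then have "(h \<theta> s)\<^sup>2 \<le> C * (2 * \<bar>f s\<bar> + (s + l) + norm t) / s\<^sup>2"
        by (simp add: h_def power_divide divide_right_mono)
      also have "\<dots> = U s"
        using elim by (simp add: U_def field_simps power2_eq_square)
      finally show ?case
        by simp
    qed
    ultimately have "((\<lambda>s. (h \<theta> s)\<^sup>2) \<longlongrightarrow> 0) at_top"
      by (rule Lim_null_comparison[rotated])
    then show ?thesis
      by (simp add: power_tendsto_0_iff)
  qed
  have n12: "cos \<theta> * n $ 1 + sin \<theta> * n $ 2 = 0" for \<theta>
  proof -
    \<comment> \<open>Opposite points of a parallel have the same height, so subtracting cancels the
      \<open>g\<close> and \<open>t\<close> terms and doubles the horizontal one.\<close>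
    have "((\<lambda>s. h \<theta> s - h (\<theta> + pi) s) \<longlongrightarrow> 0 - 0) at_top"
      by (intro tendsto_diff h0)
    moreover have "h \<theta> s - h (\<theta> + pi) s = f s / s * (2 * (cos \<theta> * n $ 1 + sin \<theta> * n $ 2))" for s
      by (simp add: h_eq algebra_simps)
    moreover have "((\<lambda>s. f s / s * (2 * (cos \<theta> * n $ 1 + sin \<theta> * n $ 2)))
        \<longlongrightarrow> \<beta> * (2 * (cos \<theta> * n $ 1 + sin \<theta> * n $ 2))) at_top"
      by (intro tendsto_intros f)
    ultimately have "\<beta> * (2 * (cos \<theta> * n $ 1 + sin \<theta> * n $ 2)) = 0 - 0"
      by (simp only: tendsto_unique[OF trivial_limit_at_top_linorder])
    then show ?thesis
      using f(2) by simp
  qed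
  have "n $ 1 = 0" "n $ 2 = 0"
    using n12[of 0] n12[of "pi / 2"] by simp_all
  moreover have "n $ 3 = 0"
  proof -
    \<comment> \<open>With \<open>n\<close> vertical, h 0 s + (t \<bullet> n) / s is g s / s times
      \<open>n $ 3\<close>. A lower bound on g s / s is enough here, without knowing its
      limit.\<close>
    have "((\<lambda>s. \<bar>h 0 s + (t \<bullet> n) / s\<bar>) \<longlongrightarrow> \<bar>0 + 0\<bar>) at_top"
      by (intro tendsto_intros h0) real_asymp
    moreover have "((\<lambda>s. (\<gamma> + k / s) * \<bar>n $ 3\<bar>) \<longlongrightarrow> (\<gamma> + 0) * \<bar>n $ 3\<bar>) at_top"
      by (intro tendsto_intros) real_asymp
    moreover have "eventually (\<lambda>s. (\<gamma> + k / s) * \<bar>n $ 3\<bar> \<le> \<bar>h 0 s + (t \<bullet> n) / s\<bar>) at_top"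
      using eventually_gt_at_top[of 0]
    proof eventually_elim
      case (elim s)
      have "h 0 s + (t \<bullet> n) / s = g s / s * n $ 3"
        by (simp add: h_eq \<open>n $ 1 = 0\<close>)
      moreover have "\<gamma> + k / s \<le> g s / s"
      proof -
        have "\<gamma> + k / s = (\<gamma> * s + k) / s"
          using elim by (simp add: add_divide_distrib)
        also have "\<dots> \<le> g s / s"
          using elim by (intro divide_right_mono g(1)) auto
        finally show ?thesis .
      qed
      ultimately show ?case
        by (simp only: abs_mult) (rule mult_right_mono, linarith, rule abs_ge_zero)
    qed
    ultimately have "(\<gamma> + 0) * \<bar>n $ 3\<bar> \<le> \<bar>0 + 0\<bar>"
      by (intro tendsto_le[OF trivial_limit_at_top_linorder])
    with \<gamma> show ?thesis
      by (simp add: mult_le_0_iff)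
  qed
  ultimately have "n = 0"
    by (simp add: vec_eq_iff forall_3)
  with n show False
    by simp
qed

section \<open>The family of profiles\<close>

theorem theorem3p3:
  fixes b c d :: real and f g :: "real \<Rightarrow> real"
  assumes "0 < b" and "b \<le> 1" and "c\<^sup>2 < b * d"
    and "\<forall>s. f s = sqrt (b * s\<^sup>2 + 2 * c * s + d)"
    and "rotational_ricci_surface UNIV f g"
    and "\<forall>s \<theta>. gauss_curvature (rot_param f g) s \<theta> < 0"
  shows "proper_rotational_surface UNIV f g
    \<and> (\<exists>T. vertical_isometry T \<and> symmetric_xy_plane (T ` rotational_surface UNIV f g))
    \<and> (catenoid (rotational_surface UNIV f g) \<longleftrightarrow> b = 1)"
proof -
  \<comment> \<open>\<open>a\<close> is the vertex of the parabola under the root, and completing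
    the square gives b f^2 = (b s + c)^2 + e^2. For b = 1, \<open>e\<close> is the neck radius,
    attained at s = -c.\<close>
  define a where "a = - c / b"
  define e where "e = sqrt (b * d - c\<^sup>2)"
  have b: "b > 0" and e: "e > 0" "e\<^sup>2 = b * d - c\<^sup>2"
    using assms(1,3) by (auto simp: e_def)
  have prof: "rotational_profile UNIV f g"
    using assms(5) by (simp add: rotational_ricci_surface_def)
  note Dg = rotational_profile_UNIV_DERIV(2)[OF prof]
  have quad: "b * (b * s\<^sup>2 + 2 * c * s + d) = (b * s + c)\<^sup>2 + e\<^sup>2" for s
    unfolding e(2) by (simp add: power2_eq_square algebra_simps)
  have quad_pos: "b * s\<^sup>2 + 2 * c * s + d > 0" for s
  proof -
    have "0 < b * (b * s\<^sup>2 + 2 * c * s + d)"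
      unfolding quad using e(1) by (intro add_nonneg_pos) auto
    with b show ?thesis
      by (simp add: zero_less_mult_iff)
  qed
  have f: "f s = sqrt (b * s\<^sup>2 + 2 * c * s + d)" for s
    using assms(4) by blast
  have f2: "b * (f s)\<^sup>2 = (b * s + c)\<^sup>2 + e\<^sup>2" for s
    using quad_pos[of s] by (simp add: f quad less_imp_le)
  have f_pos: "f s > 0" for s
    using quad_pos[of s] by (simp add: f)
  have Df: "(f has_real_derivative (b * s + c) / f s) (at s)" for s
    unfolding f[abs_def] using quad_pos[of s]
    by (auto intro!: derivative_eq_intros simp: field_simps)
  have df: "(deriv f s)\<^sup>2 = b * (b * s + c)\<^sup>2 / ((b * s + c)\<^sup>2 + e\<^sup>2)" for s
    unfolding DERIV_imp_deriv[OF Df] f2[symmetric] using b f_pos[of s]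
    by (simp add: power_divide power2_eq_square)
  have df_le: "(deriv f s)\<^sup>2 \<le> b" for s
  proof -
    have "b * (b * s + c)\<^sup>2 \<le> b * ((b * s + c)\<^sup>2 + e\<^sup>2)" "(b * s + c)\<^sup>2 + e\<^sup>2 > 0"
      using b e(1) by (simp_all add: add_nonneg_pos)
    then show ?thesis
      unfolding df by (simp only: pos_divide_le_eq)
  qed
  have even: "f (a + t) = f (a - t)" for t
    using b by (simp add: f a_def power2_eq_square field_simps)

  have "proper_rotational_surface UNIV f g"
  proof (rule proper_rotational_surface_UNIV)
    show "continuous_on UNIV f" "continuous_on UNIV g"
      using DERIV_isCont[OF Df] DERIV_isCont[OF Dg] by (simp_all add: continuous_on_eq_continuous_at)
    fix r
    have "\<bar>s\<bar> \<le> (b * r\<^sup>2 + 1 + \<bar>c\<bar>) / b" if "\<bar>f s\<bar> \<le> r" for s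
    proof -
      have "(b * s + c)\<^sup>2 \<le> b * r\<^sup>2"
        using f2[of s] b abs_le_square_iff[of "f s" r] that
        by (smt (verit) mult_left_mono zero_le_power2)
      \<comment> \<open>The crude estimate |x| <= x^2 + 1 bounds \<open>s\<close> without taking a
        root.\<close>
      moreover have "\<bar>b * s + c\<bar> \<le> (b * s + c)\<^sup>2 + 1"
        using sum_squares_bound[of "\<bar>b * s + c\<bar>" 1] by (auto; argo)
      ultimately have "\<bar>b * s\<bar> \<le> b * r\<^sup>2 + 1 + \<bar>c\<bar>"
        by linarith
      with b show ?thesis
        by (simp add: field_simps abs_mult)
    qed
    then show "bounded {s. \<bar>f s\<bar> \<le> r}"
      by (auto simp: bounded_iff)
  qed

  moreover have "\<exists>T. vertical_isometry T \<and> symmetric_xy_plane (T ` rotational_surface UNIV f g)"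
  proof (intro exI conjI)
    show "vertical_isometry (vertical_translation (- g a))"
      by (rule vertical_isometry_translation)
    show "symmetric_xy_plane (vertical_translation (- g a) ` rotational_surface UNIV f g)"
      unfolding vertical_translation_rotational_surface
      using rotational_profile_odd[OF prof even]
      by (intro symmetric_xy_plane_rotational_surface[where a = a] even) (simp add: algebra_simps)
  qed

  moreover have "catenoid (rotational_surface UNIV f g)" if "b = 1"
  proof -
    \<comment> \<open>For b = 1, with x = (s + c) / e, one has 1 - f'^2 = 1 / (x^2 + 1), so g' is
      the derivative of e arsinh x.\<close>
    have "((\<lambda>s. g s - e * arsinh ((s + c) / e)) has_real_derivative 0) (at s)" for s
    proof -
      have "sqrt (1 - (deriv f s)\<^sup>2) = sqrt (1 / (((s + c) / e)\<^sup>2 + 1))"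
        unfolding df using that e(1)
        by (simp add: divide_simps add_nonneg_pos less_imp_neq[symmetric])
      then show ?thesis
        using e(1) by (auto intro!: derivative_eq_intros Dg DERIV_chain2[OF arsinh_real_has_field_derivative]
            simp: real_sqrt_divide)
    qed
    \<comment> \<open>The base point -c makes the arsinh term vanish, so the constant is the height
      of the neck.\<close>
    then have *: "g s - e * arsinh ((s + c) / e) = g (- c) - e * arsinh ((- c + c) / e)" for s
      using DERIV_isconst_all[of "\<lambda>s. g s - e * arsinh ((s + c) / e)"] by blast
    have g: "g s = g (- c) + e * arsinh ((s + c) / e)" for s
      using *[of s] by (simp add: diff_eq_eq)
    show ?thesis
    proof (rule catenoid_rotational_surface)
      show "e > 0" by fact
      show "f s = e * cosh ((g s - g (- c)) / e)" for s
      proof -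
        have "(f s)\<^sup>2 = e\<^sup>2 * (((s + c) / e)\<^sup>2 + 1)"
          using f2[of s] that e(1) by (simp add: power_divide distrib_left)
        then have "f s = sqrt (e\<^sup>2 * (((s + c) / e)\<^sup>2 + 1))"
          using f_pos[of s] by (metis real_sqrt_unique less_imp_le)
        also have "\<dots> = e * cosh (arsinh ((s + c) / e))"
          using e(1) by (simp add: cosh_arsinh_real real_sqrt_mult)
        finally show ?thesis
          using e(1) by (simp add: g[of s])
      qed
      \<comment> \<open>An explicit right inverse of \<open>g\<close>, found by solving the arsinh
        formula for \<open>s\<close>.\<close>
      have "g (e * sinh ((z - g (- c)) / e) - c) = z" for z
        using e(1) by (subst g[of "e * sinh ((z - g (- c)) / e) - c"]) (simp add: arsinh_sinh_real)
      then show "surj g"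
        by (rule surjI)
    qed
  qed

  moreover have "\<not> catenoid (rotational_surface UNIV f g)" if "b \<noteq> 1"
  \<comment> \<open>Since 1 - b <= 1 - f'^2 <= 1, the slope of \<open>g\<close> lies between sqrt (1
    - b) and 1. Integration from 0 gives both linear bounds, with offsets \<open>g 0\<close> and |g
    0|.\<close>
  proof (rule not_catenoid_of_linear_growth)
    have "b < 1"
      using that assms(2) by simp
    then show "sqrt (1 - b) > 0"
      by simp
    show "((\<lambda>s. f s / s) \<longlongrightarrow> sqrt b) at_top" "sqrt b \<noteq> 0"
      unfolding f[abs_def] using b by (real_asymp simp: powr_half_sqrt, simp)
    have mono: "sqrt (1 - b) \<le> sqrt (1 - (deriv f s)\<^sup>2)" "sqrt (1 - (deriv f s)\<^sup>2) \<le> 1" for s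
      using df_le[of s] by auto
    show lower: "sqrt (1 - b) * s + g 0 \<le> g s" if "s \<ge> 0" for s
    proof -
      have "g 0 - sqrt (1 - b) * 0 \<le> g s - sqrt (1 - b) * s"
        using that
      proof (rule DERIV_nonneg_imp_nondecreasing)
        show "\<exists>y. ((\<lambda>s. g s - sqrt (1 - b) * s) has_real_derivative y) (at x) \<and> y \<ge> 0" for x
          using mono(1)[of x]
          by (intro exI[of _ "sqrt (1 - (deriv f x)\<^sup>2) - sqrt (1 - b)"])
            (auto intro!: derivative_eq_intros Dg)
      qed
      then show ?thesis
        by simp
    qed
    show "\<bar>g s\<bar> \<le> s + \<bar>g 0\<bar>" if "s \<ge> 0" for s
    proof -
      have "0 - g 0 \<le> s - g s"
        using that
      proof (rule DERIV_nonneg_imp_nondecreasing)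
        show "\<exists>y. ((\<lambda>s. s - g s) has_real_derivative y) (at x) \<and> y \<ge> 0" for x
          using mono(2)[of x]
          by (intro exI[of _ "1 - sqrt (1 - (deriv f x)\<^sup>2)"])
            (auto intro!: derivative_eq_intros Dg)
      qed
      moreover have "0 \<le> sqrt (1 - b) * s"
        using that assms(2) by simp
      ultimately show ?thesis
        using lower[OF that] by linarith
    qed
  qed
  ultimately show ?thesis
    by blast
qed

end
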